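(* For all integers $n \ge 0$ and $r \ge 0$, \[ F_{n+2}^{(r)}=F_{n+1}^{(r)}+F_{n}^{(r)} + \binom{n+r}{r-1}. \] (For $r\ge 1$, the last term is the regular $(r-1)$-topic number $P_{n+2}^{(r-1)}$.)
   Context: $(F_n)_{n\ge 0}$ is the Fibonacci sequence with $F_0=0$, $F_1=1$, $F_{n+2}=F_{n+1}+F_n$. The hyperfibonacci sequence of $r$-th generation $(F_n^{(r)})_{n\ge 0}$ is defined by $F_n^{(0)}=F_n$ and, for $r\ge 1$, $F_n^{(r)}=\sum_{k=0}^n F_k^{(r-1)}$ (so $F_0^{(r)}=0$ and $F_1^{(r)}=1$). The $n$-th regular $r$-topic number is $P_n^{(r)}=\binom{n+r-1}{r}$. Convention: $\binom{a}{-1}=0$. *)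

theory Defs
  imports "HOL-Number_Theory.Fib"
begin

fun hyperfib :: "nat \<Rightarrow> nat \<Rightarrow> nat" where
  "hyperfib 0 n = fib n"
| "hyperfib (Suc r) n = (\<Sum>k=0..n. hyperfib r k)"

(* The truncated subtraction affects only n = r = 0, where both (-1 choose 0) and
   (0 choose 0) equal 1. *)
definition regular_topic :: "nat \<Rightarrow> nat \<Rightarrow> nat" where
  "regular_topic r n = (n + r - 1) choose r"

(* Binomial coefficient whose lower index may be negative, in which case it is 0. *)
definition binom_int :: "nat \<Rightarrow> int \<Rightarrow> nat" where
  "binom_int a k = (if k < 0 then 0 else a choose nat k)"

end

theory Submission
  imports Defs
begin

text \<open>Summing the recurrence of generation \<open>r\<close> over the index yields that of generation
  \<open>r + 1\<close>; the correction terms add up by Pascal's rule, which holds without exception once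
  negative lower indices are allowed.\<close>

lemma binom_int_Suc: "binom_int (Suc a) k = binom_int a k + binom_int a (k - 1)"
proof (cases "k \<le> 0")
  case True
  \<comment> \<open>At \<open>k = 0\<close> the term with lower index -1 vanishes and both others
    are 1.\<close>
  then show ?thesis by (auto simp: binom_int_def)
next
  case False
  then obtain m where "k = int (Suc m)"
    by (metis not_le zero_less_imp_eq_int gr0_implies_Suc)
  then show ?thesis by (simp add: binom_int_def nat_add_distrib)
qed

lemma hyperfib_0_right [simp]: "hyperfib r 0 = 0"
  by (induction r) auto

lemma hyperfib_1_right [simp]: "hyperfib r (Suc 0) = Suc 0"
  by (induction r) auto

text \<open>Replaces the defining sum in the inner induction step, where the sums stay
  folded.\<close>

lemma hyperfib_Suc_Suc: "hyperfib (Suc r) (Suc n) = hyperfib (Suc r) n + hyperfib r (Suc n)"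
  by simp

lemma hyperfib_rec:
  "hyperfib r (Suc (Suc n)) =
     hyperfib r (Suc n) + hyperfib r n + binom_int (n + r) (int r - 1)"
proof (induction r arbitrary: n)
  case 0
  \<comment> \<open>The lower index is -1, which leaves the Fibonacci recurrence.\<close>
  show ?case by (simp add: binom_int_def)
next
  case (Suc r)
  note generation_IH = Suc.IH
  show ?case
  proof (induction n)
    case 0
    \<comment> \<open>The extra 1 is \<open>r choose r\<close>; it matches the term
      \<open>hyperfib r 1\<close> in the generation \<open>r\<close> recurrence at index 0.\<close>
    have "binom_int (Suc r) (int r) = Suc (binom_int r (int r - 1))"
      by (simp add: binom_int_Suc) (simp add: binom_int_def)
    then show ?case
      using generation_IH[of 0] by simp
  next
    case (Suc n)
    \<comment> \<open>The increment of the correction is that of generation \<open>r\<close> at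
      index \<open>Suc n\<close>, as \<open>n + Suc r = Suc n + r\<close>.\<close>
    have "binom_int (Suc n + Suc r) (int r) =
        binom_int (n + Suc r) (int r) + binom_int (Suc n + r) (int r - 1)"
      using binom_int_Suc[of "n + Suc r" "int r"] by simp
    then show ?case
      using Suc.IH generation_IH[of "Suc n"] hyperfib_Suc_Suc[of r "Suc (Suc n)"]
        hyperfib_Suc_Suc[of r "Suc n"] hyperfib_Suc_Suc[of r n]
      by (simp del: hyperfib.simps)
  qed
qed

lemma binom_int_eq_regular_topic:
  assumes "r \<ge> 1"
  shows "binom_int (n + r) (int r - 1) = regular_topic (r - 1) (n + 2)"
  \<comment> \<open>For \<open>r \<ge> 1\<close> the upper index is
    \<open>(n + 2) + (r - 1) - 1 = n + r\<close>.\<close>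
  using assms by (cases r) (simp_all add: binom_int_def regular_topic_def)

theorem lemma2:
  fixes n r :: nat
  shows "hyperfib r (n + 2) =
           hyperfib r (n + 1) + hyperfib r n + binom_int (n + r) (int r - 1)
       \<and> (r \<ge> 1 \<longrightarrow> binom_int (n + r) (int r - 1) = regular_topic (r - 1) (n + 2))"
  using hyperfib_rec[of r n] binom_int_eq_regular_topic[of r n]
  by (simp del: hyperfib.simps)

end
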